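(* Let $H=(u(x,y),v(x,y,z),h(x,y))$ be a polynomial map over $\mathbf{K}[x,y,z]$, i.e. $u,h\in\mathbf{K}[x,y]$ and $v\in\mathbf{K}[x,y,z]$. Assume that $H(0)=0$ and that the components $u,v,h$ of $H$ are linearly independent over $\mathbf{K}$. If $JH$ is nilpotent and $\gcd(\deg_y u,\deg_y h)\leq 3$, then $$u=g(ay+b(x)),\qquad v=v_1z-a^{-1}b'(x)\,g(ay+b(x))-v_1l_2x,\qquad h=c_0u^2+l_2u,$$ where $b(x)=v_1c_0ax^2+l_1x+\tilde{l}_2$ for some $v_1,c_0,a\in\mathbf{K}^*$ and $l_1,l_2,\tilde{l}_2\in\mathbf{K}$, and $g(t)\in\mathbf{K}[t]$ satisfies $g(0)=0$ and $\deg_t g(t)\geq 1$.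
   Context: $\mathbf{K}$ is an algebraically closed field and $\mathbf{K}^*=\mathbf{K}\setminus\{0\}$. $JH$ denotes the $3\times 3$ Jacobian matrix of $H$ with respect to $(x,y,z)$. $\deg_y f$ is the highest degree of $y$ in $f$.
   Formalization: K is additionally assumed to have characteristic zero; in every characteristic p > 0 the claim fails, e.g. for u = x^p, v = z^p, h = x^(2p), where JH = 0 but u does not involve y. *)

theory Defs
  imports "HOL-Computational_Algebra.Polynomial" "Jordan_Normal_Form.Matrix"
begin

text \<open>
  Polynomial rings are iterated: \<open>'a poly poly\<close> is \<open>K[x][y]\<close> and \<open>'a poly poly poly\<close>
  is \<open>K[x][y][z]\<close>; the outermost variable is the last one.
\<close>

definition const3 :: "'a::comm_ring_1 \<Rightarrow> 'a poly poly poly" where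
  "const3 c = [:[:[:c:]:]:]"

definition X3 :: "'a::comm_ring_1 poly poly poly" where "X3 = [:[:[:0, 1:]:]:]"
definition Y3 :: "'a::comm_ring_1 poly poly poly" where "Y3 = [:[:0, 1:]:]"
definition Z3 :: "'a::comm_ring_1 poly poly poly" where "Z3 = [:0, 1:]"

definition incl_xy :: "'a::comm_ring_1 poly poly \<Rightarrow> 'a poly poly poly" where
  "incl_xy f = [:f:]"

definition subst3 :: "'a::comm_ring_1 poly \<Rightarrow> 'a poly poly poly \<Rightarrow> 'a poly poly poly" where
  "subst3 g q = poly (map_poly const3 g) q"  \<comment> \<open>\<open>g(q)\<close> for a univariate \<open>g\<close> over \<open>K\<close>\<close>

definition eval3 :: "'a::comm_ring_1 poly poly poly \<Rightarrow> 'a \<Rightarrow> 'a \<Rightarrow> 'a \<Rightarrow> 'a" where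
  "eval3 f x y z = poly (poly (poly f [:[:z:]:]) [:y:]) x"

definition deg_y :: "'a::zero poly poly \<Rightarrow> nat" where
  "deg_y f = degree f"

definition d_dx :: "'a::idom poly poly poly \<Rightarrow> 'a poly poly poly" where
  "d_dx = map_poly (map_poly pderiv)"
definition d_dy :: "'a::idom poly poly poly \<Rightarrow> 'a poly poly poly" where
  "d_dy = map_poly pderiv"
definition d_dz :: "'a::idom poly poly poly \<Rightarrow> 'a poly poly poly" where
  "d_dz = pderiv"

definition jacobian_mat ::
  "'a::idom poly poly poly \<Rightarrow> 'a poly poly poly \<Rightarrow> 'a poly poly poly \<Rightarrow> 'a poly poly poly mat"
where
  "jacobian_mat H1 H2 H3 = mat_of_rows_list 3
     [[d_dx H1, d_dy H1, d_dz H1],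
      [d_dx H2, d_dy H2, d_dz H2],
      [d_dx H3, d_dy H3, d_dz H3]]"

definition nilpotent_mat :: "'a::semiring_1 mat \<Rightarrow> bool" where
  "nilpotent_mat A \<longleftrightarrow> square_mat A \<and> (\<exists>k. A ^\<^sub>m k = 0\<^sub>m (dim_row A) (dim_row A))"

text \<open>Linear independence over \<open>K\<close> of a family (so repeated members are dependent).\<close>

definition lin_indep3 ::
  "'a::comm_ring_1 poly poly poly \<Rightarrow> 'a poly poly poly \<Rightarrow> 'a poly poly poly \<Rightarrow> bool"
where
  "lin_indep3 f1 f2 f3 \<longleftrightarrow>
     (\<forall>c1 c2 c3. const3 c1 * f1 + const3 c2 * f2 + const3 c3 * f3 = 0
        \<longrightarrow> c1 = 0 \<and> c2 = 0 \<and> c3 = 0)"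

end

theory Submission
  imports Defs "HOL-Computational_Algebra.Polynomial_Factorial" "Jordan_Normal_Form.Determinant"
begin

text \<open>
  Nilpotency of the Jacobian means that its trace, the sum of its principal $2\times 2$ minors and
  its determinant vanish. Comparing powers of \<open>z\<close> gives \<open>v = W(x,y) + v\<^sub>1 z\<close> with constant \<open>v\<^sub>1\<close> and
  \<open>u\<^sub>y \<noteq> 0\<close>, and with \<open>k = v\<^sub>1 h\<close> the conditions become \<open>W\<^sub>y = -u\<^sub>x\<close>, \<open>k\<^sub>y + u\<^sub>y W\<^sub>x + u\<^sub>x\<^sup>2 = 0\<close> and
  \<open>u\<^sub>x k\<^sub>y = u\<^sub>y k\<^sub>x\<close>.

  The derivation \<open>\<delta> = \<partial>\<^sub>x - (u\<^sub>x/u\<^sub>y) \<partial>\<^sub>y\<close> of \<open>K(x,y)\<close> differentiates along the level curves of \<open>u\<close>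
  parametrised by \<open>x\<close>. It commutes with \<open>u\<^sub>y\<^sup>-\<^sup>1 \<partial>\<^sub>y\<close> and \<open>\<delta> W = -k\<^sub>y/u\<^sub>y\<close>, which yields \<open>\<delta>\<^sup>3 y = 0\<close>: the
  level curves are parabolas. In the weights 1 for \<open>x\<close> and 2 for \<open>y\<close>, the component of \<open>u\<close> of top
  weight \<open>d\<close> turns \<open>\<delta>\<^sup>d u = 0\<close> into an algebraic equation over \<open>K\<close> for \<open>\<delta>\<^sup>2 y\<close>, so that
  \<open>\<delta>\<^sup>2 y = 2\<lambda>\<close> with \<open>\<lambda> \<in> K\<close>. The same argument with weights 1 and 1, applied to
  \<open>y - \<lambda>x\<^sup>2\<close>, shows that \<open>\<delta> (y - \<lambda>x\<^sup>2)\<close> is in \<open>K\<close> as well. Hence \<open>u\<^sub>x = b'(x) u\<^sub>y\<close> for a polynomial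
  \<open>b\<close> of degree at most 2, \<open>u\<close> is a polynomial in \<open>y + b(x)\<close>, and \<open>W\<close> and \<open>k\<close> follow by integration.
\<close>

section \<open>Derivations and fraction fields\<close>

locale derivation =
  fixes D :: "'r::comm_ring_1 \<Rightarrow> 'r"
  assumes add: "D (a + b) = D a + D b"
    and mult: "D (a * b) = D a * b + a * D b"
begin

lemma zero [simp]: "D 0 = 0"
  using add[of 0 0] by simp

lemma one [simp]: "D 1 = 0"
  using mult[of 1 1] by simp

lemma minus: "D (- a) = - D a"
  using add[of a "- a"] by (simp add: eq_neg_iff_add_eq_0 add.commute)

lemma diff: "D (a - b) = D a - D b"
  using add[of a "- b"] minus[of b] by simp

lemma of_nat [simp]: "D (of_nat n) = 0"
  by (induction n) (simp_all add: add)

lemma numeral [simp]: "D (numeral n) = 0"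
  using of_nat[of "numeral n"] by simp

lemma sum: "D (sum f S) = (\<Sum>i\<in>S. D (f i))"
  by (induction S rule: infinite_finite_induct) (simp_all add: add)

end

lemma (in derivation) commutator:
  assumes "derivation E"
  shows "derivation (\<lambda>a. D (E a) - E (D a))"
proof -
  interpret E: derivation E by fact
  show ?thesis
    by unfold_locales (simp_all add: add mult E.add E.mult algebra_simps)
qed

lemma derivation_pderiv: "derivation (pderiv :: 'a::idom poly \<Rightarrow> _)"
  by unfold_locales (simp_all add: pderiv_add pderiv_mult algebra_simps)

lemma (in derivation) derivation_map_poly: "derivation (map_poly D)"
proof
  fix p q :: "'r poly"
  show "map_poly D (p + q) = map_poly D p + map_poly D q"
    by (rule poly_eqI) (simp add: coeff_map_poly add)
  show "map_poly D (p * q) = map_poly D p * q + p * map_poly D q"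
    by (rule poly_eqI) (simp add: coeff_map_poly coeff_mult sum mult sum.distrib)
qed

lemma map_poly_pderiv:
  fixes D :: "'r::idom \<Rightarrow> 'r"
  assumes "derivation D"
  shows "map_poly D (pderiv p) = pderiv (map_poly D p)"
proof -
  interpret derivation D by fact
  show ?thesis
    by (rule poly_eqI) (simp add: coeff_map_poly coeff_pderiv mult del: of_nat_Suc)
qed

text \<open>Fractions inherit characteristic 0, so the factorials accumulated by repeated
  differentiation can be cancelled in K(x,y).\<close>

instance fract :: ("{idom, ring_char_0}") field_char_0
proof
  have "(of_nat n :: 'a fract) = to_fract (of_nat n)" for n
    by (induction n) simp_all
  then show "inj (of_nat :: nat \<Rightarrow> 'a fract)"
    by (auto simp: inj_on_def)
qed

text \<open>The quotient rule on representatives. A definite description is used because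
  independence of the representative requires \<open>D\<close> to be a derivation.\<close>

definition fract_deriv :: "('r::idom \<Rightarrow> 'r) \<Rightarrow> 'r fract \<Rightarrow> 'r fract" where
  "fract_deriv D z =
     (THE w. \<exists>a b. b \<noteq> 0 \<and> z = Fract a b \<and> w = Fract (D a * b - a * D b) (b * b))"

lemma fract_deriv_Fract:
  fixes D :: "'r::idom \<Rightarrow> 'r"
  assumes D: "derivation D" and "b \<noteq> 0"
  shows "fract_deriv D (Fract a b) = Fract (D a * b - a * D b) (b * b)"
  unfolding fract_deriv_def
proof (rule the_equality)
  show "\<exists>a' b'. b' \<noteq> 0 \<and> Fract a b = Fract a' b' \<and>
      Fract (D a * b - a * D b) (b * b) = Fract (D a' * b' - a' * D b') (b' * b')"
    using \<open>b \<noteq> 0\<close> by blast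
next
  interpret derivation D by fact
  fix w assume "\<exists>a' b'. b' \<noteq> 0 \<and> Fract a b = Fract a' b' \<and>
      w = Fract (D a' * b' - a' * D b') (b' * b')"
  then obtain c d where cd: "d \<noteq> 0" "Fract a b = Fract c d"
    "w = Fract (D c * d - c * D d) (d * d)" by blast
  then have eq: "a * d = c * b"
    using \<open>b \<noteq> 0\<close> by (simp add: eq_fract)
  \<comment> \<open>Differentiating the cross-multiplied equality of the two fractions eliminates
    \<open>D c\<close>.\<close>
  then have "D a * d + a * D d = D c * b + c * D b"
    by (metis mult)
  then have Dc: "D c * b = D a * d + a * D d - c * D b"
    by (simp add: algebra_simps)
  have "(D c * d - c * D d) * (b * b) = (D c * b) * d * b - (c * b) * D d * b"
    by (simp add: algebra_simps)
  also have "\<dots> = D a * b * (d * d) - (c * b) * D b * d"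
    unfolding Dc eq[symmetric] by (simp add: algebra_simps eq)
  also have "\<dots> = (D a * b - a * D b) * (d * d)"
    unfolding eq[symmetric] by (simp add: algebra_simps)
  finally have "(D c * d - c * D d) * (b * b) = (D a * b - a * D b) * (d * d)" .
  then show "w = Fract (D a * b - a * D b) (b * b)"
    using cd \<open>b \<noteq> 0\<close> by (simp add: eq_fract)
qed

lemma derivation_fract_deriv:
  assumes D: "derivation D"
  shows "derivation (fract_deriv D)"
proof
  interpret derivation D by fact
  fix x y :: "'a fract"
  obtain a b where x: "x = Fract a b" "b \<noteq> 0" by (cases x)
  obtain c d where y: "y = Fract c d" "d \<noteq> 0" by (cases y)
  show "fract_deriv D (x + y) = fract_deriv D x + fract_deriv D y"
    using x y by (simp add: fract_deriv_Fract[OF D] eq_fract add mult algebra_simps)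
  show "fract_deriv D (x * y) = fract_deriv D x * y + x * fract_deriv D y"
    using x y by (simp add: fract_deriv_Fract[OF D] eq_fract add mult algebra_simps)
qed

lemma fract_deriv_to_fract:
  assumes D: "derivation D"
  shows "fract_deriv D (to_fract a) = to_fract (D a)"
proof -
  interpret derivation D by fact
  show ?thesis by (simp add: to_fract_def fract_deriv_Fract[OF D])
qed

text \<open>Applying \<open>D\<close> to \<open>z * b = a\<close> with \<open>a\<close>,
  \<open>b\<close> in the ring leaves \<open>D z * b = 0\<close>.\<close>

lemma derivation_fract_eq_0:
  assumes D: "derivation D" and "\<And>a. D (to_fract a) = 0"
  shows "D z = 0"
proof -
  interpret derivation D by fact
  obtain a b where z: "z = Fract a b" "b \<noteq> 0" by (cases z)
  then have "z * to_fract b = to_fract a"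
    by (simp add: to_fract_def eq_fract)
  then have "D z * to_fract b = 0"
    using mult[of z "to_fract b"] assms(2) by simp
  then show ?thesis using \<open>b \<noteq> 0\<close> by simp
qed

text \<open>The commutator of two derivations is again a derivation, so it suffices that it vanishes
  on the ring.\<close>

lemma fract_deriv_commute:
  assumes D: "derivation D" and E: "derivation E" and "\<And>a. D (E a) = E (D a)"
  shows "fract_deriv D (fract_deriv E z) = fract_deriv E (fract_deriv D z)"
proof -
  have "derivation (\<lambda>z. fract_deriv D (fract_deriv E z) - fract_deriv E (fract_deriv D z))"
    by (intro derivation.commutator derivation_fract_deriv D E)
  then have "fract_deriv D (fract_deriv E z) - fract_deriv E (fract_deriv D z) = 0"
    by (rule derivation_fract_eq_0) (simp add: fract_deriv_to_fract D E assms(3))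
  then show ?thesis by simp
qed

section \<open>Leading coefficients along a derivation\<close>

text \<open>In characteristic 0, \<open>leading D n a c\<close> says that $D^{n+1} a = 0$ and $D^n a = n!\, c$.\<close>

fun leading :: "('r::comm_ring_1 \<Rightarrow> 'r) \<Rightarrow> nat \<Rightarrow> 'r \<Rightarrow> 'r \<Rightarrow> bool" where
  "leading D 0 a c \<longleftrightarrow> a = c \<and> D c = 0"
| "leading D (Suc n) a c \<longleftrightarrow> leading D n (D a) (of_nat (Suc n) * c)"

context derivation
begin

lemma leading_zero: "leading D n 0 0"
  by (induction n) simp_all

lemma leading_add:
  "leading D n a c \<Longrightarrow> leading D n b e \<Longrightarrow> leading D n (a + b) (c + e)"
  by (induction n arbitrary: a b c e) (auto simp: add distrib_left simp del: of_nat_Suc)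

lemma leading_sum:
  "(\<And>i. i \<in> S \<Longrightarrow> leading D n (f i) (g i)) \<Longrightarrow> leading D n (sum f S) (sum g S)"
  by (induction S rule: infinite_finite_induct) (auto simp: leading_zero leading_add)

lemma leading_Suc: "leading D n a c \<Longrightarrow> leading D (Suc n) a 0"
proof (induction n arbitrary: a c)
  case (Suc n)
  then have "leading D (Suc n) (D a) 0" by simp
  then show ?case by simp
qed simp

lemma leading_less: "leading D n a c \<Longrightarrow> n < m \<Longrightarrow> leading D m a 0"
proof (induction m)
  case (Suc m)
  then show ?case using leading_Suc by (metis less_antisym)
qed simp

text \<open>Thanks to the normalisation by \<open>n!\<close>, these behave like leading coefficients
  of polynomials in a parameter differentiated by \<open>D\<close>. In the product rule the two
  summands contribute the factors \<open>m\<close> and \<open>n\<close>, which add up to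
  \<open>m + n\<close>.\<close>

lemma leading_mult:
  "leading D m a c \<Longrightarrow> leading D n b e \<Longrightarrow> leading D (m + n) (a * b) (c * e)"
proof (induction "m + n" arbitrary: m n a b c e)
  case 0
  then show ?case by (simp add: mult)
next
  case (Suc N)
  have left: "leading D N (D a * b) (of_nat m * (c * e))"
  proof (cases m)
    case 0
    then show ?thesis using Suc.prems by (simp add: leading_zero)
  next
    case (Suc m')
    with Suc.hyps(2) have N: "N = m' + n" by simp
    have "leading D m' (D a) (of_nat (Suc m') * c)"
      using Suc.prems(1) Suc by simp
    from Suc.hyps(1)[OF N this Suc.prems(2)] show ?thesis
      using Suc N by (simp add: mult.assoc del: of_nat_Suc)
  qed
  have right: "leading D N (a * D b) (of_nat n * (c * e))"
  proof (cases n)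
    case 0
    then show ?thesis using Suc.prems by (simp add: leading_zero)
  next
    case (Suc n')
    with Suc.hyps(2) have N: "N = m + n'" by simp
    have "leading D n' (D b) (of_nat (Suc n') * e)"
      using Suc.prems(2) Suc by simp
    from Suc.hyps(1)[OF N Suc.prems(1) this] show ?thesis
      using Suc N by (simp add: mult.left_commute del: of_nat_Suc)
  qed
  have "leading D N (D (a * b)) (of_nat (Suc N) * (c * e))"
    using leading_add[OF left right] Suc.hyps(2)
    by (simp add: mult distrib_right[symmetric] of_nat_add[symmetric] del: of_nat_Suc of_nat_add)
  then show ?case using Suc.hyps(2)[symmetric] by simp
qed

lemma leading_power: "leading D n a c \<Longrightarrow> leading D (n * j) (a ^ j) (c ^ j)"
proof (induction j)
  case (Suc j)
  then show ?case using leading_mult[of n a c "n * j"] by (simp add: add.commute)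
qed simp

end

lemma leading_zero_imp:
  fixes D :: "'r::field_char_0 \<Rightarrow> 'r"
  shows "leading D n 0 c \<Longrightarrow> derivation D \<Longrightarrow> c = 0"
proof (induction n arbitrary: c)
  case (Suc n)
  interpret derivation D by fact
  from Suc have "of_nat (Suc n) * c = 0" by (metis leading.simps(2) zero)
  then show ?case by (simp del: of_nat_Suc)
qed simp

section \<open>Elements algebraic over an algebraically closed field of constants\<close>

locale field_embedding =
  fixes \<iota> :: "'a::{alg_closed_field, field_char_0} \<Rightarrow> 'b::field_char_0"
  assumes hom_add: "\<iota> (a + b) = \<iota> a + \<iota> b"
    and hom_mult: "\<iota> (a * b) = \<iota> a * \<iota> b"
    and hom_1: "\<iota> 1 = 1"
begin

lemma hom_0: "\<iota> 0 = 0"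
  using hom_add[of 0 0] by simp

lemma hom_minus: "\<iota> (- a) = - \<iota> a"
  using hom_add[of a "- a"] hom_0 by (simp add: eq_neg_iff_add_eq_0 add.commute)

lemma hom_diff: "\<iota> (a - b) = \<iota> a - \<iota> b"
  using hom_add[of a "- b"] by (simp add: hom_minus)

lemma hom_eq_0: "\<iota> a = 0 \<longleftrightarrow> a = 0"
  using hom_mult[of a "inverse a"] hom_0 hom_1 by (cases "a = 0") auto

text \<open>Split off one root of \<open>p\<close> at a time: \<open>A\<close> is either the image
  of that root or a zero of the quotient, which has smaller degree.\<close>

lemma algebraic_in_range:
  "p \<noteq> 0 \<Longrightarrow> poly (map_poly \<iota> p) A = 0 \<Longrightarrow> \<exists>a. A = \<iota> a"
proof (induction "degree p" arbitrary: p)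
  case 0
  then obtain c where "p = [:c:]" "c \<noteq> 0" by (metis degree_eq_zeroE pCons_0_0)
  with 0 show ?case by (simp add: map_poly_pCons hom_0 hom_eq_0)
next
  case (Suc n)
  then obtain r where "poly p r = 0"
    using alg_closed_imp_poly_has_root[of p] by auto
  then obtain q where p: "p = [:- r, 1:] * q" by (metis dvdE poly_eq_0_iff_dvd)
  with Suc.prems(1) have "q \<noteq> 0" by auto
  moreover from this have "degree p = Suc (degree q)"
    unfolding p by (subst degree_mult_eq) auto
  ultimately have q: "q \<noteq> 0" "degree q = n"
    using Suc.hyps(2) by auto
  have "map_poly \<iota> p = [:- \<iota> r, 1:] * map_poly \<iota> q"
    unfolding p
    by (rule poly_eqI)
      (simp add: coeff_map_poly hom_0 hom_add hom_mult hom_minus hom_diff coeff_pCons split: nat.split)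
  then have "poly (map_poly \<iota> p) A = (A - \<iota> r) * poly (map_poly \<iota> q) A"
    by (simp add: left_diff_distrib)
  with Suc.prems(2) have "A - \<iota> r = 0 \<or> poly (map_poly \<iota> q) A = 0" by simp
  then show ?case
    using Suc.hyps(1)[of q] q by auto
qed

text \<open>Written out in monomials so that \<open>leading\<close> can be read off term by term;
  \<open>x\<close> replaces the inner variable and \<open>t\<close> the outer one.\<close>

definition eval2 :: "'a poly poly \<Rightarrow> 'b \<Rightarrow> 'b \<Rightarrow> 'b" where
  "eval2 p x t = (\<Sum>j\<le>degree p. \<Sum>i\<le>degree (coeff p j). \<iota> (coeff (coeff p j) i) * x ^ i * t ^ j)"

text \<open>Give \<open>x\<close> weight 1 and \<open>t\<close> weight \<open>w\<close>. The
  monomial \<open>x ^ i * t ^ j\<close> then has order \<open>i + w * j\<close> and leading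
  coefficient \<open>A ^ j\<close>, so the monomials of top weight \<open>d\<close> produce a
  nonzero polynomial over K in \<open>A\<close>. As \<open>D\<close> kills the whole sum and
  \<open>d > 0\<close>, this polynomial vanishes at \<open>A\<close>.\<close>

lemma leading_in_range:
  assumes D: "derivation D" and const: "\<And>a. D (\<iota> a) = 0"
    and x: "D x = 1" and t: "leading D w t A" "w > 0"
    and p: "degree p > 0" "D (eval2 p x t) = 0"
  shows "\<exists>a. A = \<iota> a"
proof -
  interpret derivation D by fact
  define S where "S = (\<lambda>(j, i). i + w * j) ` {(j, i). j \<le> degree p \<and> i \<le> degree (coeff p j) \<and> coeff (coeff p j) i \<noteq> 0}"
  have "{(j, i). j \<le> degree p \<and> i \<le> degree (coeff p j) \<and> coeff (coeff p j) i \<noteq> 0} =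
      Sigma {..degree p} (\<lambda>j. {i. i \<le> degree (coeff p j) \<and> coeff (coeff p j) i \<noteq> 0})" by auto
  then have fin: "finite S" unfolding S_def by simp
  have in_S: "i + w * j \<in> S" if "coeff (coeff p j) i \<noteq> 0" for i j
  proof -
    have "j \<le> degree p" "i \<le> degree (coeff p j)"
      using that by (auto intro!: le_degree)
    with that show ?thesis unfolding S_def by force
  qed
  define d where "d = Max S"
  define j1 where "j1 = degree p"
  define i1 where "i1 = degree (coeff p j1)"
  have top: "coeff (coeff p j1) i1 \<noteq> 0"
    using p(1) unfolding i1_def j1_def by auto
  have "i1 + w * j1 \<le> d" unfolding d_def using fin in_S[OF top] by simp
  moreover have "w * j1 > 0" using p(1) t(2) j1_def by simp
  ultimately have d: "d > 0" by linarith
  have "d \<in> S" unfolding d_def using fin in_S[OF top] by (intro Max_in) auto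
  then obtain i0 j0 where ij0: "coeff (coeff p j0) i0 \<noteq> 0" "d = i0 + w * j0" "j0 \<le> degree p"
    unfolding S_def by auto
  \<comment> \<open>The component of \<open>p\<close> of weight \<open>d\<close> with
    \<open>x\<close> set to 1. The guard excludes truncated subtraction in
    \<open>d - w * j\<close>.\<close>
  define U where "U = (\<Sum>j\<le>degree p. monom (if w * j \<le> d then coeff (coeff p j) (d - w * j) else 0) j)"
  have coeff_U: "coeff U j0 = coeff (coeff p j0) i0"
    unfolding U_def using ij0 by (simp add: coeff_sum)
  then have "U \<noteq> 0" using ij0 by auto
  have lead1: "leading D d (\<iota> (coeff (coeff p j) i) * x ^ i * t ^ j)
      (if i + w * j = d then \<iota> (coeff (coeff p j) i) * A ^ j else 0)" for i j
  proof (cases "coeff (coeff p j) i = 0")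
    case True
    then show ?thesis by (auto simp: hom_0 leading_zero)
  next
    case False
    have "leading D 1 x 1" using x by simp
    then have "leading D i (x ^ i) 1" using leading_power[of 1 x 1 i] by simp
    moreover have "leading D 0 (\<iota> (coeff (coeff p j) i)) (\<iota> (coeff (coeff p j) i))"
      by (simp add: const)
    ultimately have "leading D i (\<iota> (coeff (coeff p j) i) * x ^ i) (\<iota> (coeff (coeff p j) i))"
      using leading_mult by fastforce
    then have L: "leading D (i + w * j) (\<iota> (coeff (coeff p j) i) * x ^ i * t ^ j) (\<iota> (coeff (coeff p j) i) * A ^ j)"
      using leading_power[OF t(1)] leading_mult by blast
    have "i + w * j \<le> d" unfolding d_def using fin in_S[OF False] by simp
    then consider "i + w * j = d" | "i + w * j < d" by linarith
    then show ?thesis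
      using L leading_less[OF L] by cases auto
  qed
  have inner: "(\<Sum>i\<le>degree (coeff p j). if i + w * j = d then \<iota> (coeff (coeff p j) i) * A ^ j else 0)
      = \<iota> (if w * j \<le> d then coeff (coeff p j) (d - w * j) else 0) * A ^ j" (is "?l = ?r") for j
  proof (cases "w * j \<le> d")
    case True
    have "?l = (\<Sum>i\<le>degree (coeff p j). if i = d - w * j then \<iota> (coeff (coeff p j) i) * A ^ j else 0)"
      using True by (intro sum.cong) auto
    also have "\<dots> = ?r"
      using True by (auto simp: hom_0 coeff_eq_0)
    finally show ?thesis .
  next
    case False
    then show ?thesis by (auto simp: hom_0 intro!: sum.neutral)
  qed
  have "map_poly \<iota> U = (\<Sum>j\<le>degree p. monom (\<iota> (if w * j \<le> d then coeff (coeff p j) (d - w * j) else 0)) j)"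
    by (rule poly_eqI) (auto simp: U_def coeff_map_poly hom_0 coeff_sum)
  then have "poly (map_poly \<iota> U) A =
      (\<Sum>j\<le>degree p. \<iota> (if w * j \<le> d then coeff (coeff p j) (d - w * j) else 0) * A ^ j)"
    by (simp add: poly_sum poly_monom)
  then have "leading D d (eval2 p x t) (poly (map_poly \<iota> U) A)"
    unfolding eval2_def inner[symmetric] by (auto intro!: leading_sum lead1)
  \<comment> \<open>Positivity of \<open>d\<close> allows one unfolding of \<open>leading\<close>,
    which replaces the sum by its derivative, namely 0.\<close>
  moreover obtain d' where "d = Suc d'" using d by (cases d) auto
  ultimately have "leading D d' 0 (of_nat (Suc d') * poly (map_poly \<iota> U) A)"
    using p(2) by simp
  then have "of_nat (Suc d') * poly (map_poly \<iota> U) A = 0"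
    using D leading_zero_imp by blast
  then have "poly (map_poly \<iota> U) A = 0" by (simp del: of_nat_Suc)
  with \<open>U \<noteq> 0\<close> show ?thesis by (rule algebraic_in_range)
qed

end

section \<open>Level curves\<close>

text \<open>\<open>\<phi>\<close> is the slope of the level curves of \<open>u\<close>. It equals
  \<open>dy W / dy u\<close>, so its derivative along the curves comes from that of
  \<open>W\<close>, which is \<open>- (dy k / dy u)\<close>. Dividing \<open>dy\<close> by
  \<open>dy u\<close> preserves constancy along the curves, and \<open>k\<close> is constant along
  them.\<close>

lemma second_derivative_along_level_curve:
  fixes dx dy :: "'r::field \<Rightarrow> 'r" and u k W :: 'r
  assumes dx: "derivation dx" and dy: "derivation dy" and comm: "\<And>z. dx (dy z) = dy (dx z)"
    and u: "dy u \<noteq> 0" and W: "dy W = - dx u"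
    and k: "dy k + dy u * dx W + (dx u)\<^sup>2 = 0" and uk: "dx u * dy k = dy u * dx k"
  defines "\<phi> \<equiv> - (dx u / dy u)"
  defines "\<delta> \<equiv> \<lambda>z. dx z + \<phi> * dy z"
  shows "derivation \<delta>" "\<delta> u = 0" "\<delta> (\<delta> \<phi>) = 0"
proof -
  interpret dx: derivation dx by fact
  interpret dy: derivation dy by fact
  show "derivation \<delta>"
    by unfold_locales (simp_all add: \<delta>_def dx.add dy.add dx.mult dy.mult algebra_simps)
  then interpret \<delta>: derivation \<delta> .
  show \<delta>u: "\<delta> u = 0" using u by (simp add: \<delta>_def \<phi>_def)
  have \<delta>k: "\<delta> k = 0" using u uk by (simp add: \<delta>_def \<phi>_def field_simps)
  have dy\<delta>: "dy (\<delta> z) = \<delta> (dy z) + dy \<phi> * dy z" for z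
    by (simp add: \<delta>_def dy.add dy.mult comm)
  have \<delta>dyu: "\<delta> (dy u) = - (dy \<phi> * dy u)"
    using dy\<delta>[of u] by (simp add: \<delta>u eq_neg_iff_add_eq_0)
  have const: "\<delta> (dy z / dy u) = 0" if "\<delta> z = 0" for z
  proof -
    define r where "r = dy z / dy u"
    have r: "dy z = r * dy u" using u by (simp add: r_def)
    have "0 = \<delta> (dy z) + dy \<phi> * dy z" using dy\<delta>[of z] that by simp
    also have "\<dots> = \<delta> r * dy u"
      unfolding r \<delta>.mult \<delta>dyu by (simp add: algebra_simps)
    finally show ?thesis using u r_def by simp
  qed
  define r where "r = dy k / dy u"
  have "\<phi> * dy u = - dx u" using u by (simp add: \<phi>_def)
  then have W': "dy W = \<phi> * dy u" using W by simp
  have "dy k + dy u * dx W + (\<phi> * dy u)\<^sup>2 = 0"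
    using k \<open>\<phi> * dy u = - dx u\<close> by simp
  \<comment> \<open>Since \<open>dy W = \<phi> * dy u\<close>, the square in the minor condition is
    exactly \<open>dy u * (\<phi> * dy W)\<close>, the part that completes \<open>dx W\<close> to
    \<open>\<delta> W\<close>.\<close>
  then have "dy u * (\<delta> W + r) = 0"
    unfolding \<delta>_def W' r_def using u
    by (simp add: algebra_simps power2_eq_square)
  then have \<delta>W: "\<delta> W = - r" using u by (simp add: eq_neg_iff_add_eq_0)
  have "dy (\<delta> W) = \<delta> \<phi> * dy u"
    unfolding dy\<delta>[of W] W' \<delta>.mult \<delta>dyu by (simp add: algebra_simps)
  then have "\<delta> \<phi> = - (dy r / dy u)"
    using u \<delta>W by (simp add: dy.minus field_simps)
  moreover have "\<delta> (dy r / dy u) = 0"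
    using const[OF const[OF \<delta>k, folded r_def]] .
  ultimately show "\<delta> (\<delta> \<phi>) = 0" by (simp add: \<delta>.minus)
qed

section \<open>Level curves in K(x,y)\<close>

lemma field_embedding_to_fract: "field_embedding (\<lambda>a. to_fract [:[:a::'a::{alg_closed_field, field_char_0}:]:])"
  by unfold_locales (simp_all flip: to_fract_add to_fract_mult one_pCons)

abbreviation dX :: "'a::idom poly poly \<Rightarrow> 'a poly poly" where
  "dX \<equiv> map_poly pderiv"

lemmas derivation_dX = derivation.derivation_map_poly[OF derivation_pderiv]

lemma const_poly_power: "[:p ^ i:] = [:p::'r::comm_semiring_1:] ^ i"
proof (induction i)
  case (Suc i)
  have "[:p * p ^ i:] = [:p:] * [:p ^ i:]" by (simp add: power_commutes)
  then show ?case by (simp only: Suc power_Suc)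
qed (simp flip: one_pCons)

lemma const_poly_sum: "[:sum f S:] = (\<Sum>i\<in>S. [:f i:])"
  by (rule poly_eqI) (simp add: coeff_sum coeff_pCons split: nat.split)

lemma poly_in_x_eq_sum:
  fixes c :: "'a::comm_ring_1 poly"
  shows "[:c:] = (\<Sum>i\<le>degree c. [:[:coeff c i:]:] * [:[:0, 1:]:] ^ i)"
proof -
  have "[:c:] = [:\<Sum>i\<le>degree c. monom (coeff c i) i:]"
    by (simp add: poly_as_sum_of_monoms)
  also have "\<dots> = (\<Sum>i\<le>degree c. [:[:coeff c i:]:] * [:[:0, 1:]:] ^ i)"
    unfolding const_poly_sum by (simp add: monom_altdef const_poly_power[symmetric])
  finally show ?thesis .
qed

lemma pcompose_eq_sum: "pcompose p q = (\<Sum>j\<le>degree p. [:coeff p j:] * q ^ j)"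
  for p q :: "'a::idom poly"
  by (simp add: pcompose_altdef poly_altdef coeff_map_poly degree_map_poly)

lemma to_fract_sum: "to_fract (sum f S) = (\<Sum>i\<in>S. to_fract (f i))"
  by (induction S rule: infinite_finite_induct) simp_all

lemma to_fract_power: "to_fract (a ^ n) = to_fract a ^ n"
  by (induction n) simp_all

text \<open>With \<open>x\<close> kept fixed, substituting into both variables is composition over
  K[x]. This allows any polynomial \<open>q\<close> to serve as the second coordinate.\<close>

lemma eval2_to_fract:
  fixes p q :: "'a::{alg_closed_field, field_char_0} poly poly"
  shows "field_embedding.eval2 (\<lambda>a. to_fract [:[:a:]:]) p (to_fract [:[:0, 1:]:]) (to_fract q)
    = to_fract (pcompose p q)"
proof -
  have "(\<Sum>i\<le>degree c. to_fract [:[:coeff c i:]:] * to_fract [:[:0, 1:]:] ^ i) = to_fract [:c:]"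
    for c :: "'a poly"
    by (subst (2) poly_in_x_eq_sum) (simp only: to_fract_sum to_fract_mult to_fract_power)
  then show ?thesis
    unfolding field_embedding.eval2_def[OF field_embedding_to_fract] pcompose_eq_sum
    by (simp only: to_fract_sum to_fract_mult to_fract_power sum_distrib_right[symmetric])
qed

text \<open>A priori the slope \<open>\<phi>\<close> is only a rational function. Algebraicity over
  K first makes its derivative along the curves constant, and then what remains of it after
  subtracting a multiple of \<open>x\<close>.\<close>

lemma level_curves_parabolas:
  fixes u k W :: "'a::{alg_closed_field, field_char_0} poly poly"
  assumes u: "pderiv u \<noteq> 0" and W: "pderiv W = - dX u"
    and k: "pderiv k + pderiv u * dX W + (dX u)\<^sup>2 = 0" and uk: "dX u * pderiv k = pderiv u * dX k"
  shows "\<exists>c1 c2. dX u = [:[:c1, c2:]:] * pderiv u"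
proof -
  define dx dy :: "'a poly poly fract \<Rightarrow> 'a poly poly fract"
    where "dx = fract_deriv dX" and "dy = fract_deriv pderiv"
  have der: "derivation dx" "derivation dy"
    unfolding dx_def dy_def by (intro derivation_fract_deriv derivation_dX derivation_pderiv)+
  have comm: "dx (dy z) = dy (dx z)" for z
    unfolding dx_def dy_def
    by (intro fract_deriv_commute derivation_dX derivation_pderiv map_poly_pderiv)
  have dx: "dx (to_fract a) = to_fract (dX a)" and dy: "dy (to_fract a) = to_fract (pderiv a)" for a
    unfolding dx_def dy_def by (simp_all add: fract_deriv_to_fract derivation_dX derivation_pderiv)
  define \<phi> where "\<phi> = - (dx (to_fract u) / dy (to_fract u))"
  define \<delta> where "\<delta> = (\<lambda>z. dx z + \<phi> * dy z)"
  have u': "dy (to_fract u) \<noteq> 0" using u by (simp add: dy)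
  have "dy (to_fract W) = - dx (to_fract u)"
    unfolding dx dy W by (simp add: to_fract_uminus)
  moreover have "dy (to_fract k) + dy (to_fract u) * dx (to_fract W) + (dx (to_fract u))\<^sup>2 = 0"
    unfolding dx dy by (simp only: k flip: to_fract_mult to_fract_add to_fract_power to_fract_0)
  moreover have "dx (to_fract u) * dy (to_fract k) = dy (to_fract u) * dx (to_fract k)"
    unfolding dx dy by (simp only: uk flip: to_fract_mult)
  ultimately have \<delta>: "derivation \<delta>" "\<delta> (to_fract u) = 0" "\<delta> (\<delta> \<phi>) = 0"
    using second_derivative_along_level_curve[OF der comm u']
    unfolding \<delta>_def \<phi>_def by blast+
  interpret \<delta>: derivation \<delta> by fact
  define \<iota> :: "'a \<Rightarrow> 'a poly poly fract" where "\<iota> = (\<lambda>a. to_fract [:[:a:]:])"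
  interpret \<iota>: field_embedding \<iota> unfolding \<iota>_def by (rule field_embedding_to_fract)
  define x y :: "'a poly poly fract" where "x = to_fract [:[:0, 1:]:]" and "y = to_fract [:0, 1:]"
  have \<delta>\<iota>: "\<delta> (\<iota> a) = 0" for a
    unfolding \<delta>_def \<iota>_def dx dy by (simp add: map_poly_pCons)
  have \<delta>x: "\<delta> x = 1"
    unfolding \<delta>_def x_def dx dy by (simp add: map_poly_pCons pderiv_pCons one_pCons[symmetric])
  have \<delta>y: "\<delta> y = \<phi>"
    unfolding \<delta>_def y_def dx dy
    by (simp add: map_poly_pCons pderiv_pCons derivation.one[OF derivation_dX] one_pCons[symmetric])
  have deg: "degree u > 0" using u pderiv_eq_0_iff by auto

  \<comment> \<open>Here \<open>\<delta> y = \<phi>\<close>, and the division by 2 is the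
    normalisation by \<open>2!\<close>.\<close>
  have "leading \<delta> 2 y (\<delta> \<phi> / 2)"
    by (simp add: numeral_2_eq_2 \<delta>y \<delta>)
  moreover have "\<delta> (\<iota>.eval2 u x y) = 0"
    unfolding \<iota>_def x_def y_def eval2_to_fract using \<delta>(2) by simp
  ultimately obtain l where l: "\<delta> \<phi> / 2 = \<iota> l"
    using \<iota>.leading_in_range[OF \<delta>(1) \<delta>\<iota> \<delta>x _ _ deg, of 2 y "\<delta> \<phi> / 2"] by auto
  then have \<delta>\<phi>: "\<delta> \<phi> = 2 * \<iota> l" by (simp add: field_simps)

  \<comment> \<open>The new coordinate is \<open>q = y - l x^2\<close>; \<open>q'\<close> is the
    inverse substitution, so \<open>pcompose u q'\<close> is \<open>u\<close> written in
    \<open>x\<close> and \<open>q\<close>.\<close>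
  define q q' :: "'a poly poly" where "q = [:[:0, 0, - l:], 1:]" and "q' = [:[:0, 0, l:], 1:]"
  have t: "to_fract q = y - \<iota> l * x\<^sup>2"
    unfolding q_def y_def x_def \<iota>_def
    by (simp flip: to_fract_mult to_fract_power to_fract_diff add: power2_eq_square)
  have \<delta>t: "\<delta> (to_fract q) = \<phi> - 2 * \<iota> l * x"
    unfolding t \<delta>.diff \<delta>.mult power2_eq_square by (simp add: \<delta>y \<delta>\<iota> \<delta>x algebra_simps)
  have "\<delta> (\<delta> (to_fract q)) = 0"
    unfolding \<delta>t \<delta>.diff \<delta>.mult by (simp add: \<delta>\<iota> \<delta>x \<delta>\<phi>)
  then have lead: "leading \<delta> 1 (to_fract q) (\<phi> - 2 * \<iota> l * x)"
    using \<delta>t by simp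
  have deg': "degree (pcompose u q') > 0" using deg by (simp add: q'_def degree_pcompose)
  have "pcompose (pcompose u q') q = u"
    by (simp add: pcompose_assoc[symmetric] q_def q'_def pcompose_pCons)
  then have "\<delta> (\<iota>.eval2 (pcompose u q') x (to_fract q)) = 0"
    unfolding \<iota>_def x_def eval2_to_fract using \<delta>(2) by simp
  then obtain m where m: "\<phi> - 2 * \<iota> l * x = \<iota> m"
    using \<iota>.leading_in_range[OF \<delta>(1) \<delta>\<iota> \<delta>x lead _ deg'] by auto

  have "\<phi> = \<iota> m + 2 * \<iota> l * x" using m by (simp add: algebra_simps)
  also have "2 * \<iota> l = \<iota> (2 * l)" using \<iota>.hom_add[of l l] by simp
  also have "\<iota> m + \<iota> (2 * l) * x = to_fract [:[:m, 2 * l:]:]"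
    unfolding \<iota>_def x_def by (simp flip: to_fract_mult to_fract_add)
  finally have "- dx (to_fract u) = to_fract [:[:m, 2 * l:]:] * dy (to_fract u)"
    using u' by (simp add: \<phi>_def field_simps)
  then have "dx (to_fract u) = - (to_fract [:[:m, 2 * l:]:] * dy (to_fract u))"
    by (metis minus_minus)
  then have "to_fract (dX u) = to_fract (- ([:[:m, 2 * l:]:] * pderiv u))"
    unfolding dx dy to_fract_mult[symmetric] to_fract_uminus[symmetric] .
  then have "dX u = - [:[:m, 2 * l:]:] * pderiv u"
    by (simp only: to_fract_eq_iff minus_mult_left)
  also have "- [:[:m, 2 * l:]:] = [:[:- m, - (2 * l):]:]" by simp
  finally show ?thesis by blast
qed

section \<open>Integration of the planar equations\<close>

lemma dX_const [simp]: "dX [:c:] = [:pderiv c:]"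
  by (simp add: map_poly_pCons)

lemma pderiv_eq_0_imp_const:
  fixes p :: "'a::{idom, ring_char_0} poly"
  assumes "pderiv p = 0"
  shows "p = [:coeff p 0:]"
  using pderiv_iszero[OF assms] by force

text \<open>The chain rule for the shear replacing \<open>y\<close> by
  \<open>y + b(x)\<close>.\<close>

lemma dX_pcompose:
  "dX (pcompose p [:b, 1:]) = pcompose (dX p) [:b, 1:] + pcompose (pderiv p) [:b, 1:] * [:pderiv b:]"
proof (induction p)
  case 0
  then show ?case by simp
next
  case (pCons a p)
  interpret dX: derivation dX by (rule derivation_dX)
  have "dX [:b, 1:] = [:pderiv b:]"
    by (simp add: map_poly_pCons flip: one_pCons)
  then have *: "dX (pcompose (pCons a p) [:b, 1:]) =
      [:pderiv a:] + ([:pderiv b:] * pcompose p [:b, 1:] + [:b, 1:] * dX (pcompose p [:b, 1:]))"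
    unfolding pcompose_pCons dX.add dX.mult dX_const by simp
  have pd: "pderiv (pCons a p) = p + [:0, 1:] * pderiv p"
    by (simp add: pderiv_pCons)
  have mp: "dX (pCons a p) = pCons (pderiv a) (dX p)"
    by (simp add: map_poly_pCons)
  show ?case
    unfolding *
    unfolding pd mp pCons.IH pcompose_add pcompose_mult pcompose_pCons
    by (simp add: algebra_simps del: mult_pCons_left mult_pCons_right)
qed

text \<open>The inverse shear straightens the curves \<open>y + b(x) = const\<close>: after it
  \<open>u\<close> no longer depends on \<open>x\<close>, so its coefficients lie in K.\<close>

lemma transport_solution:
  fixes u :: "'a::{idom, ring_char_0} poly poly"
  assumes "dX u = [:pderiv b:] * pderiv u"
  shows "\<exists>g. u = pcompose (map_poly (\<lambda>c. [:c:]) g) [:b, 1:]"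
proof -
  define p where "p = pcompose u [:- b, 1:]"
  have "dX p = 0"
    unfolding p_def dX_pcompose assms pcompose_mult
    by (simp add: pderiv_minus mult.commute)
  then have "pderiv (coeff p i) = 0" for i
    by (metis coeff_0 coeff_map_poly pderiv_0)
  then have "coeff p i = [:coeff (coeff p i) 0:]" for i
    by (rule pderiv_eq_0_imp_const)
  then have "p = map_poly (\<lambda>c. [:c:]) (map_poly (\<lambda>c. coeff c 0) p)"
    by (intro poly_eqI) (simp add: coeff_map_poly)
  moreover have "u = pcompose p [:b, 1:]"
    unfolding p_def by (simp add: pcompose_assoc[symmetric] pcompose_pCons)
  ultimately show ?thesis by metis
qed

lemma poly_map_poly_const: "poly (map_poly (\<lambda>c. [:c:]) g) b = pcompose g b"
  by (simp add: pcompose_altdef)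

lemma planar_solution:
  fixes u k W :: "'a::{alg_closed_field, field_char_0} poly poly"
  assumes u: "pderiv u \<noteq> 0" and W: "pderiv W = - dX u"
    and k: "pderiv k + pderiv u * dX W + (dX u)\<^sup>2 = 0" and uk: "dX u * pderiv k = pderiv u * dX k"
    and u0: "poly (poly u 0) 0 = 0" and W0: "poly (poly W 0) 0 = 0" and k0: "poly (poly k 0) 0 = 0"
  shows "\<exists>g l c m. u = pcompose (map_poly (\<lambda>c. [:c:]) g) [:[:0, l, c:], 1:] \<and> poly g 0 = 0 \<and>
    W = - ([:pderiv [:0, l, c:]:] * u) + [:[:0, m:]:] \<and> k = [:[:c:]:] * u\<^sup>2 - [:[:m:]:] * u"
proof -
  interpret dX: derivation dX by (rule derivation_dX)
  interpret dY: derivation "pderiv :: 'a poly poly \<Rightarrow> _" by (rule derivation_pderiv)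
  obtain c1 c2 where c12: "dX u = [:[:c1, c2:]:] * pderiv u"
    using level_curves_parabolas[OF u W k uk] by blast
  define b where "b = [:0, c1, c2 / 2:]"
  have b': "pderiv b = [:c1, c2:]" by (simp add: b_def pderiv_pCons)
  define B where "B = [:pderiv b:]"
  have dxu: "dX u = B * pderiv u" by (simp only: c12 B_def b')
  have dyB: "pderiv B = 0" by (simp add: B_def)
  have dxB: "dX B = [:[:c2:]:]" by (simp add: B_def b' pderiv_pCons)
  obtain g where g: "u = pcompose (map_poly (\<lambda>c. [:c:]) g) [:b, 1:]"
    using transport_solution dxu unfolding B_def by blast
  have "poly (poly u 0) 0 = poly g 0"
    unfolding g poly_pcompose by (simp add: poly_map_poly_const poly_pcompose b_def)
  with u0 have g0: "poly g 0 = 0" by simp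

  \<comment> \<open>\<open>B\<close> is free of \<open>y\<close> and
    \<open>pderiv W = - B * pderiv u\<close>, so \<open>W + B * u\<close> depends on
    \<open>x\<close> alone.\<close>
  have "pderiv (W + B * u) = 0"
    unfolding dY.add dY.mult dyB W dxu by simp
  then obtain w where "W + B * u = [:w:]" using pderiv_eq_0_imp_const by blast
  then have Weq: "W = [:w:] - B * u" by (simp add: algebra_simps)
  have dxW: "dX W = [:pderiv w:] - [:[:c2:]:] * u - B * (B * pderiv u)"
    unfolding Weq dX.diff dX.mult dX_const dxB dxu by (simp only: diff_diff_eq)
  \<comment> \<open>Inserting \<open>dX W\<close> into the minor condition, the two terms with
    \<open>B\<close> squared cancel.\<close>
  have dyk: "pderiv k = pderiv u * ([:[:c2:]:] * u - [:pderiv w:])"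
  proof -
    have "pderiv k - pderiv u * ([:[:c2:]:] * u - [:pderiv w:]) =
        pderiv k + pderiv u * ([:pderiv w:] - [:[:c2:]:] * u - B * (B * pderiv u)) + (B * pderiv u)\<^sup>2"
      by (simp add: power2_eq_square ring_distribs mult_ac)
    also have "\<dots> = 0"
      using k unfolding dxW dxu .
    finally show ?thesis by simp
  qed
  \<comment> \<open>The derivation along the level curves, now polynomial because the slope is
    \<open>- B\<close>. It kills \<open>u\<close> and \<open>k\<close>, and it commutes with
    \<open>pderiv\<close> because \<open>B\<close> is free of \<open>y\<close>.\<close>
  define T where "T = (\<lambda>p. dX p - B * pderiv p)"
  interpret T: derivation T
    by unfold_locales (simp_all add: T_def dX.add dY.add dX.mult dY.mult algebra_simps)
  have Tu: "T u = 0" by (simp add: T_def dxu)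
  have Tk: "T k = 0"
  proof -
    have "pderiv u * T k = dX u * pderiv k - dX u * pderiv k"
      unfolding T_def using uk dxu by (auto simp: right_diff_distrib mult_ac)
    then show ?thesis using u by simp
  qed
  have T_dy: "T (pderiv p) = pderiv (T p)" for p
    unfolding T_def dY.diff dY.mult dyB by (simp add: map_poly_pderiv[OF derivation_pderiv])
  have Tconst: "T [:a:] = [:pderiv a:]" for a by (simp add: T_def)
  \<comment> \<open>Applying \<open>T\<close> to \<open>dyk\<close> kills the left side and every
    part of the right side except the derivative of \<open>pderiv w\<close>; hence \<open>w\<close>
    is affine.\<close>
  have "pderiv u * [:pderiv (pderiv w):] = - T (pderiv u * ([:[:c2:]:] * u - [:pderiv w:]))"
    unfolding T.mult T.diff T_dy Tu Tconst by simp
  also have "\<dots> = 0"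
    unfolding dyk[symmetric] T_dy Tk by simp
  finally have "pderiv (pderiv w) = 0" using u by simp
  then obtain m where m: "pderiv w = [:m:]" using pderiv_eq_0_imp_const by blast
  have "pderiv (w - [:0, m:]) = 0" by (simp add: pderiv_diff m pderiv_pCons)
  then obtain w0 where "w - [:0, m:] = [:w0:]" using pderiv_eq_0_imp_const by blast
  then have w: "w = [:w0, m:]" by (simp add: algebra_simps)
  have "w0 = 0" using W0 u0 unfolding Weq w by simp

  \<comment> \<open>The difference of \<open>k\<close> and its claimed value. Both \<open>T\<close>
    and \<open>pderiv\<close> kill it, so it is a constant, and it vanishes at the origin.\<close>
  define F where "F = k - [:[:c2 / 2:]:] * u\<^sup>2 + [:[:m:]:] * u"
  have TF: "T F = 0"
    unfolding F_def T.add T.diff T.mult power2_eq_square Tu Tk Tconst by simp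
  have c2: "[:[:c2:]:] = [:[:c2 / 2:]:] + [:[:c2 / 2:]:]" by simp
  have dyF: "pderiv F = 0"
    unfolding F_def dY.add dY.diff dY.mult power2_eq_square dyk m c2
    by (simp add: algebra_simps del: add_pCons)
  have "dX F = 0" using TF dyF unfolding T_def by simp
  obtain f where f: "F = [:f:]" using dyF pderiv_eq_0_imp_const by blast
  with \<open>dX F = 0\<close> have "pderiv f = 0" by simp
  then obtain f0 where "f = [:f0:]" using pderiv_eq_0_imp_const by blast
  moreover have "poly (poly F 0) 0 = 0" unfolding F_def using u0 k0 by simp
  ultimately have "F = 0" using f by simp
  then have "k = [:[:c2 / 2:]:] * u\<^sup>2 - [:[:m:]:] * u"
    unfolding F_def by (simp add: algebra_simps)
  moreover have "W = - (B * u) + [:[:0, m:]:]"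
    unfolding Weq w \<open>w0 = 0\<close> by simp
  ultimately show ?thesis using g g0 unfolding B_def b_def by blast
qed

section \<open>Nilpotent three by three matrices\<close>

lemma det_2x2:
  assumes A: "(A :: 'r::comm_ring_1 mat) \<in> carrier_mat 2 2"
  shows "det A = A $$ (0,0) * A $$ (1,1) - A $$ (0,1) * A $$ (1,0)"
proof -
  have "det A = (\<Sum>j<2. A $$ (0,j) * cofactor A 0 j)"
    using laplace_expansion_row[OF A, of 0] by simp
  also have "\<dots> = A $$ (0,0) * cofactor A 0 0 + A $$ (0,1) * cofactor A 0 1"
    by (simp add: numeral_2_eq_2)
  also have "cofactor A 0 0 = A $$ (1,1)"
    using A by (simp add: cofactor_def det_single mat_delete_def)
  also have "cofactor A 0 1 = - A $$ (1,0)"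
    using A by (simp add: cofactor_def det_single mat_delete_def)
  finally show ?thesis by simp
qed

lemma det_3x3:
  assumes A: "(A :: 'r::comm_ring_1 mat) \<in> carrier_mat 3 3"
  shows "det A = A $$ (0,0) * (A $$ (1,1) * A $$ (2,2) - A $$ (1,2) * A $$ (2,1))
    - A $$ (0,1) * (A $$ (1,0) * A $$ (2,2) - A $$ (1,2) * A $$ (2,0))
    + A $$ (0,2) * (A $$ (1,0) * A $$ (2,1) - A $$ (1,1) * A $$ (2,0))"
proof -
  have minor: "mat_delete A i j \<in> carrier_mat 2 2" for i j
    using mat_delete_carrier[OF A, of i j] by simp
  have "det A = (\<Sum>j<3. A $$ (0,j) * cofactor A 0 j)"
    using laplace_expansion_row[OF A, of 0] by simp
  also have "\<dots> = A $$ (0,0) * cofactor A 0 0 + A $$ (0,1) * cofactor A 0 1 + A $$ (0,2) * cofactor A 0 2"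
    by (simp add: numeral_3_eq_3 numeral_2_eq_2)
  also have "cofactor A 0 0 = A $$ (1,1) * A $$ (2,2) - A $$ (1,2) * A $$ (2,1)"
    unfolding cofactor_def det_2x2[OF minor] using A by (simp add: mat_delete_def numeral_2_eq_2)
  also have "cofactor A 0 1 = - (A $$ (1,0) * A $$ (2,2) - A $$ (1,2) * A $$ (2,0))"
    unfolding cofactor_def det_2x2[OF minor] using A by (simp add: mat_delete_def numeral_2_eq_2)
  also have "cofactor A 0 2 = A $$ (1,0) * A $$ (2,1) - A $$ (1,1) * A $$ (2,0)"
    unfolding cofactor_def det_2x2[OF minor] using A by (simp add: mat_delete_def numeral_2_eq_2)
  finally show ?thesis by (simp add: algebra_simps)
qed

text \<open>The telescoping factorisation of \<open>x ^ k - C ^ k\<close>, with \<open>S\<close>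
  updated to \<open>S * C + x ^ k\<close>. For \<open>C ^ k = 0\<close> it makes
  \<open>det (x - C)\<close> divide a power of \<open>x\<close>.\<close>

lemma geometric_sum_mat:
  fixes C :: "'r::comm_ring_1 mat"
  assumes C: "C \<in> carrier_mat n n"
  shows "\<exists>S \<in> carrier_mat n n. (x \<cdot>\<^sub>m 1\<^sub>m n - C) * S = x ^ k \<cdot>\<^sub>m 1\<^sub>m n - C ^\<^sub>m k"
proof (induction k)
  case 0
  have "(x \<cdot>\<^sub>m 1\<^sub>m n - C) * 0\<^sub>m n n = 1\<^sub>m n - 1\<^sub>m n" using C by auto
  moreover have "x ^ 0 \<cdot>\<^sub>m 1\<^sub>m n - C ^\<^sub>m 0 = 1\<^sub>m n - 1\<^sub>m n" using C by (intro eq_matI) auto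
  ultimately show ?case by (intro bexI[of _ "0\<^sub>m n n"]) simp_all
next
  case (Suc k)
  then obtain S where S: "S \<in> carrier_mat n n"
    and eq: "(x \<cdot>\<^sub>m 1\<^sub>m n - C) * S = x ^ k \<cdot>\<^sub>m 1\<^sub>m n - C ^\<^sub>m k" by blast
  define M where "M = x \<cdot>\<^sub>m 1\<^sub>m n - C"
  define P where "P = C ^\<^sub>m k"
  have M: "M \<in> carrier_mat n n" and P: "P \<in> carrier_mat n n"
    unfolding M_def P_def using C by auto
  have "M * (S * C + x ^ k \<cdot>\<^sub>m 1\<^sub>m n) = M * S * C + x ^ k \<cdot>\<^sub>m M"
  proof -
    have "M * (S * C + x ^ k \<cdot>\<^sub>m 1\<^sub>m n) = M * (S * C) + M * (x ^ k \<cdot>\<^sub>m 1\<^sub>m n)"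
      using M S C by (intro mult_add_distrib_mat[of _ n n _ n]) auto
    also have "M * (S * C) = M * S * C"
      using assoc_mult_mat[OF M S C] by simp
    also have "M * (x ^ k \<cdot>\<^sub>m 1\<^sub>m n) = x ^ k \<cdot>\<^sub>m M"
      using M mult_smult_distrib[OF M one_carrier_mat, of "x ^ k"] by simp
    finally show ?thesis .
  qed
  also have "M * S = x ^ k \<cdot>\<^sub>m 1\<^sub>m n - P" unfolding M_def P_def by (rule eq)
  also have "(x ^ k \<cdot>\<^sub>m 1\<^sub>m n - P) * C = x ^ k \<cdot>\<^sub>m C - P * C"
    using P C by (simp add: minus_mult_distrib_mat[of _ n n _ _ n] mult_smult_assoc_mat[of _ n n _ n])
  also have "x ^ k \<cdot>\<^sub>m C - P * C + x ^ k \<cdot>\<^sub>m M = x ^ Suc k \<cdot>\<^sub>m 1\<^sub>m n - P * C"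
    using C P by (intro eq_matI) (auto simp: M_def algebra_simps)
  finally show ?case
    using S C unfolding M_def P_def by (intro bexI[of _ "S * C + x ^ k \<cdot>\<^sub>m 1\<^sub>m n"]) auto
qed

text \<open>For the product, the order at 0 equals the degree. Neither factor has order exceeding
  its degree, so equality holds for both.\<close>

lemma factor_of_monom:
  fixes p q :: "'r::idom poly"
  assumes "p * q = monom 1 N"
  shows "p = monom (lead_coeff p) (degree p)"
proof -
  have pq: "p \<noteq> 0" "q \<noteq> 0" using assms by auto
  have "monom (1::'r) N = [:- 0, 1:] ^ N" by (simp add: monom_altdef)
  then have "order 0 (p * q) = N" unfolding assms by (simp only: order_power_n_n)
  moreover have "degree (p * q) = N" unfolding assms by (simp add: degree_monom_eq)
  moreover have "order 0 p \<le> degree p" "order 0 q \<le> degree q"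
    using pq by (auto intro: order_degree)
  ultimately have "order 0 p = degree p"
    using pq order_mult[of p q 0] degree_mult_eq[of p q] by auto
  then have "[:0, 1:] ^ degree p dvd p" using order_1[of 0 p] by simp
  then have "monom 1 (degree p) dvd p" by (simp add: monom_altdef)
  then have "coeff p i = 0" if "i < degree p" for i
    using that monom_1_dvd_iff' by blast
  then show ?thesis by (intro poly_eqI) (metis coeff_eq_0 coeff_monom linorder_neqE_nat)
qed

text \<open>The characteristic polynomial divides a power of the variable, so being monic of degree
  3 it is a pure cube. Its lower coefficients are, up to sign, the three invariants.\<close>

lemma nilpotent_mat_3x3:
  fixes A :: "'r::idom mat"
  assumes A: "A \<in> carrier_mat 3 3" and nil: "nilpotent_mat A"
  shows "A $$ (0,0) + A $$ (1,1) + A $$ (2,2) = 0"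
    and "A $$ (0,0) * A $$ (1,1) - A $$ (0,1) * A $$ (1,0)
       + (A $$ (0,0) * A $$ (2,2) - A $$ (0,2) * A $$ (2,0))
       + (A $$ (1,1) * A $$ (2,2) - A $$ (1,2) * A $$ (2,1)) = 0"
    and "det A = 0"
proof -
  obtain k where k: "A ^\<^sub>m k = 0\<^sub>m 3 3"
    using nil A by (auto simp: nilpotent_mat_def)
  interpret const: comm_ring_hom "\<lambda>a::'r. [:a:]"
    by unfold_locales (simp_all flip: one_pCons)
  define C where "C = map_mat (\<lambda>a. [:a:]) A"
  have C: "C \<in> carrier_mat 3 3" using A by (simp add: C_def)
  have "C ^\<^sub>m k = 0\<^sub>m 3 3"
    unfolding C_def const.mat_hom_pow[OF A, symmetric] k by (intro eq_matI) auto
  moreover have "x \<cdot>\<^sub>m 1\<^sub>m 3 - 0\<^sub>m 3 3 = x \<cdot>\<^sub>m 1\<^sub>m 3" for x :: "'r poly"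
    by (intro eq_matI) auto
  ultimately obtain S where S: "S \<in> carrier_mat 3 3"
    and "([:0, 1:] \<cdot>\<^sub>m 1\<^sub>m 3 - C) * S = [:0, 1:] ^ k \<cdot>\<^sub>m 1\<^sub>m 3"
    using geometric_sum_mat[OF C, of "[:0, 1:]" k] by auto
  moreover have car: "[:0, 1:] \<cdot>\<^sub>m 1\<^sub>m 3 - C \<in> carrier_mat 3 3" using C by auto
  ultimately have "det ([:0, 1:] \<cdot>\<^sub>m 1\<^sub>m 3 - C) * det S = monom 1 (3 * k)"
    using det_mult[OF car S, symmetric]
    by (simp add: monom_altdef power_mult mult.commute)
  then have monom: "det ([:0, 1:] \<cdot>\<^sub>m 1\<^sub>m 3 - C) =
      monom (lead_coeff (det ([:0, 1:] \<cdot>\<^sub>m 1\<^sub>m 3 - C))) (degree (det ([:0, 1:] \<cdot>\<^sub>m 1\<^sub>m 3 - C)))"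
    by (rule factor_of_monom)
  define e1 where "e1 = A $$ (0,0) + A $$ (1,1) + A $$ (2,2)"
  define e2 where "e2 = A $$ (0,0) * A $$ (1,1) - A $$ (0,1) * A $$ (1,0)
       + (A $$ (0,0) * A $$ (2,2) - A $$ (0,2) * A $$ (2,0))
       + (A $$ (1,1) * A $$ (2,2) - A $$ (1,2) * A $$ (2,1))"
  from det_3x3[OF car] have charpoly: "det ([:0, 1:] \<cdot>\<^sub>m 1\<^sub>m 3 - C) = [:- det A, e2, - e1, 1:]"
    unfolding det_3x3[OF A] e1_def e2_def using A
    by (simp add: C_def algebra_simps)
  define f where "f = [:- det A, e2, - e1, 1:]"
  have "degree f = 3" by (simp add: f_def)
  then have "f = monom (coeff f 3) 3"
    using monom unfolding charpoly f_def[symmetric] by simp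
  then have "coeff f i = 0" if "i < 3" for i
    using that by (metis coeff_monom less_irrefl)
  from this[of 0] this[of 1] this[of 2] have "det A = 0 \<and> e2 = 0 \<and> e1 = 0"
    by (simp add: f_def numeral_2_eq_2)
  then show "e1 = 0" "e2 = 0" "det A = 0" by auto
qed

lemma jacobian_mat_carrier: "jacobian_mat p q r \<in> carrier_mat 3 3"
  unfolding jacobian_mat_def mat_of_rows_list_def by (intro carrier_matI) simp_all

text \<open>As \<open>u\<close> and \<open>h\<close> do not involve \<open>z\<close>, the last
  column of the Jacobian has the single entry \<open>pderiv v\<close>, which shortens the three
  invariants.\<close>

lemma nilpotent_jacobian:
  fixes u h :: "'a::idom poly poly" and v :: "'a poly poly poly"
  assumes "nilpotent_mat (jacobian_mat (incl_xy u) v (incl_xy h))"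
  shows "[:dX u:] + map_poly pderiv v = 0"
    and "[:dX u:] * map_poly pderiv v - [:pderiv u:] * map_poly dX v
      - pderiv v * [:pderiv h:] = 0"
    and "pderiv v * [:dX u * pderiv h - pderiv u * dX h:] = 0"
proof -
  define J where "J = jacobian_mat (incl_xy u) v (incl_xy h)"
  have J: "J $$ (0,0) = [:dX u:]" "J $$ (0,1) = [:pderiv u:]" "J $$ (0,2) = 0"
    "J $$ (1,0) = map_poly dX v" "J $$ (1,1) = map_poly pderiv v" "J $$ (1,2) = pderiv v"
    "J $$ (2,0) = [:dX h:]" "J $$ (2,1) = [:pderiv h:]" "J $$ (2,2) = 0"
    by (simp_all add: J_def jacobian_mat_def mat_of_rows_list_def incl_xy_def d_dx_def d_dy_def d_dz_def map_poly_pCons)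
  have car: "J \<in> carrier_mat 3 3" unfolding J_def by (rule jacobian_mat_carrier)
  note nil = nilpotent_mat_3x3[OF car assms[folded J_def]]
  from nil(1) show "[:dX u:] + map_poly pderiv v = 0"
    unfolding J by simp
  from nil(2) show "[:dX u:] * map_poly pderiv v - [:pderiv u:] * map_poly dX v
      - pderiv v * [:pderiv h:] = 0"
    unfolding J by (simp del: mult_pCons_left mult_pCons_right)
  have "pderiv v * ([:dX u:] * [:pderiv h:] - [:pderiv u:] * [:dX h:]) = - det J"
    unfolding det_3x3[OF car] J by (simp add: algebra_simps del: mult_pCons_left mult_pCons_right)
  with nil(3) show "pderiv v * [:dX u * pderiv h - pderiv u * dX h:] = 0"
    by (simp add: mult.commute)
qed

section \<open>The theorem\<close>

text \<open>Compare powers of \<open>z\<close>. The trace makes all coefficients of \<open>v\<close>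
  beyond the constant one free of \<open>y\<close>, and the minors link consecutive coefficients. A
  degree of at least 2 would force a linear relation between \<open>u\<close> and
  \<open>h\<close>.\<close>

lemma linear_in_z:
  fixes u h :: "'a::{alg_closed_field, field_char_0} poly poly" and v :: "'a poly poly poly"
  assumes tr: "[:dX u:] + map_poly pderiv v = 0"
    and minors: "[:dX u:] * map_poly pderiv v - [:pderiv u:] * map_poly dX v - pderiv v * [:pderiv h:] = 0"
    and det: "pderiv v * [:dX u * pderiv h - pderiv u * dX h:] = 0"
    and indep: "\<And>p q. [:[:p:]:] * u + [:[:q:]:] * h = 0 \<Longrightarrow> p = 0 \<and> q = 0"
    and u0: "poly (poly u 0) 0 = 0" and h0: "poly (poly h 0) 0 = 0"
  shows "pderiv u \<noteq> 0"
    and "\<exists>W v1. v = [:W, [:[:v1:]:]:] \<and> pderiv W = - dX u \<and>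
      pderiv ([:[:v1:]:] * h) + pderiv u * dX W + (dX u)\<^sup>2 = 0 \<and>
      dX u * pderiv ([:[:v1:]:] * h) = pderiv u * dX ([:[:v1:]:] * h)"
proof -
  interpret dX: derivation dX by (rule derivation_dX)
  interpret dY: derivation "pderiv :: 'a poly poly \<Rightarrow> _" by (rule derivation_pderiv)
  have "coeff ([:dX u:] + map_poly pderiv v) n = 0" for n by (simp add: tr)
  then have "coeff [:dX u:] n + pderiv (coeff v n) = 0" for n by (simp add: coeff_map_poly)
  from this[of 0] this[of "Suc _"] have v0: "pderiv (coeff v 0) = - dX u" and vS: "pderiv (coeff v (Suc n)) = 0" for n
    by (simp_all add: eq_neg_iff_add_eq_0 add.commute)
  have "coeff ([:dX u:] * map_poly pderiv v - [:pderiv u:] * map_poly dX v - pderiv v * [:pderiv h:]) n = 0" for n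
    unfolding minors by simp
  then have e2: "dX u * pderiv (coeff v n) - pderiv u * dX (coeff v n)
      - of_nat (Suc n) * coeff v (Suc n) * pderiv h = 0" for n
    by (simp add: coeff_map_poly coeff_pderiv mult.commute mult.left_commute del: of_nat_Suc)
  have const: "\<exists>c. p = [:[:c:]:]" if x: "dX p = 0" and y: "pderiv p = 0" for p :: "'a poly poly"
  proof -
    obtain f where f: "p = [:f:]" using pderiv_eq_0_imp_const y by blast
    with x have "f = [:coeff f 0:]" using pderiv_eq_0_imp_const by simp
    with f show ?thesis by metis
  qed

  \<comment> \<open>If \<open>u\<close> depends on \<open>x\<close> only, the minors give
    \<open>(dX u)^2 = - v_1 * h_y\<close>, with \<open>v_1\<close> the coefficient of
    \<open>z\<close>. The determinant condition then leaves only \<open>dX u = 0\<close>, so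
    \<open>u\<close> is constant and hence 0.\<close>
  show u_y: "pderiv u \<noteq> 0"
  proof
    assume y: "pderiv u = 0"
    have "(dX u)\<^sup>2 + coeff v 1 * pderiv h =
        - (dX u * pderiv (coeff v 0) - pderiv u * dX (coeff v 0) - of_nat (Suc 0) * coeff v (Suc 0) * pderiv h)"
      using y by (simp add: v0 power2_eq_square)
    also have "\<dots> = 0" by (simp only: e2 minus_zero)
    finally have sq: "(dX u)\<^sup>2 = - (coeff v 1 * pderiv h)"
      by (simp only: eq_neg_iff_add_eq_0)
    have "dX u = 0"
    proof (cases "pderiv v = 0")
      case True
      then have "coeff v 1 = 0" using coeff_pderiv[of v 0] by simp
      with sq show ?thesis by simp
    next
      case False
      with det y have "dX u = 0 \<or> pderiv h = 0" by simp
      with sq show ?thesis by auto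
    qed
    with y obtain c where "u = [:[:c:]:]" using const by blast
    with u0 have "u = 0" by simp
    with indep[of 1 0] show False by simp
  qed

  have deg: "degree v \<le> 1"
  proof (rule ccontr)
    assume "\<not> degree v \<le> 1"
    then obtain n where n: "degree v = Suc (Suc n)"
      by (metis One_nat_def not0_implies_Suc not_less_eq_eq le0 le_SucI)
    then have "pderiv v \<noteq> 0" by (simp add: pderiv_eq_0_iff)
    with det have J: "dX u * pderiv h = pderiv u * dX h" by simp
    have "pderiv u * dX (coeff v (Suc (Suc n))) = 0"
      using e2[of "Suc (Suc n)"] vS[of "Suc n"] n by (simp add: coeff_eq_0)
    then obtain c where c: "coeff v (Suc (Suc n)) = [:[:c:]:]"
      using const vS[of "Suc n"] u_y by auto
    have "c \<noteq> 0" using c n by (metis leading_coeff_0_iff degree_0 pCons_0_0 nat.distinct(1))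
    obtain e where e: "coeff v (Suc n) = [:e:]"
      using pderiv_eq_0_imp_const vS by blast
    \<comment> \<open>The coefficient of \<open>z ^ (n + 1)\<close> in the
      \<open>z\<close>-derivative of \<open>v\<close>, through which \<open>h\<close> enters the
      minor condition at that power.\<close>
    define d where "d = of_nat (Suc (Suc n)) * c"
    have "d \<noteq> 0" unfolding d_def using \<open>c \<noteq> 0\<close> by (simp del: of_nat_Suc)
    define k where "k = [:[:d:]:] * h"
    have "[:[:d:]:] = of_nat (Suc (Suc n)) * [:[:c:]:]"
      unfolding d_def by (simp add: of_nat_poly del: of_nat_Suc)
    then have "dX u * pderiv [:e:] - pderiv u * [:pderiv e:] - [:[:d:]:] * pderiv h = 0"
      using e2[of "Suc n"] unfolding vS c e dX_const by (simp only:)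
    then have "[:[:d:]:] * pderiv h = - (pderiv u * [:pderiv e:])"
      by (metis diff_0 eq_iff_diff_eq_0 mult_zero_right pderiv_singleton)
    then have dyk: "pderiv k = - (pderiv u * [:pderiv e:])"
      unfolding k_def dY.mult by simp
    have Jk: "dX u * pderiv k = pderiv u * dX k"
      unfolding k_def dY.mult dX.mult by (simp add: J)
    \<comment> \<open>This combination is free of \<open>y\<close>, while its
      \<open>x\<close>-derivative is the second derivative of \<open>e\<close> times
      \<open>u\<close>. As \<open>u\<close> does depend on \<open>y\<close>, that second derivative
      vanishes and \<open>f\<close> is constant; its value at the origin is 0.\<close>
    define f where "f = k + [:pderiv e:] * u"
    have "pderiv f = 0" unfolding f_def dY.add dY.mult dyk by simp
    then obtain f0 where f0: "f = [:f0:]" using pderiv_eq_0_imp_const by blast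
    have "pderiv u * dX f = dX u * pderiv k + pderiv u * ([:pderiv (pderiv e):] * u + [:pderiv e:] * dX u)"
      unfolding f_def dX.add dX.mult Jk dX_const by (simp only: distrib_left)
    also have "\<dots> = pderiv u * ([:pderiv (pderiv e):] * u)"
      unfolding dyk by (simp add: algebra_simps)
    finally have dxf: "dX f = [:pderiv (pderiv e):] * u"
      using mult_left_cancel[OF u_y] by blast
    have "pderiv ([:pderiv (pderiv e):] * u) = 0"
      unfolding dxf[symmetric] f0 by simp
    then have "pderiv (pderiv e) = 0" using u_y unfolding dY.mult by simp
    with dxf have "dX f = 0" by simp
    with \<open>pderiv f = 0\<close> obtain f1 where "f = [:[:f1:]:]" using const by blast
    obtain p where p: "pderiv e = [:p:]"
      using \<open>pderiv (pderiv e) = 0\<close> pderiv_eq_0_imp_const by blast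
    have "poly (poly f 0) 0 = 0"
      unfolding f_def k_def using u0 h0 by simp
    with \<open>f = [:[:f1:]:]\<close> have "f = 0" by simp
    then have "[:[:p:]:] * u + [:[:d:]:] * h = 0"
      unfolding f_def k_def p by (simp add: add.commute)
    with indep \<open>d \<noteq> 0\<close> show False by blast
  qed

  define W where "W = coeff v 0"
  have "coeff v 2 = 0" using deg by (intro coeff_eq_0) simp
  then have "pderiv u * dX (coeff v 1) = 0"
    using e2[of 1] vS[of 0] by (simp add: numeral_2_eq_2)
  then obtain v1 where v1: "coeff v 1 = [:[:v1:]:]"
    using const vS[of 0] u_y by auto
  have v: "v = [:W, [:[:v1:]:]:]"
  proof (rule poly_eqI)
    fix n
    show "coeff v n = coeff [:W, [:[:v1:]:]:] n"
      using deg v1 by (cases n rule: nat.exhaust) (auto simp: W_def coeff_pCons coeff_eq_0 split: nat.split)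
  qed
  have W: "pderiv W = - dX u" unfolding W_def by (rule v0)
  have k: "pderiv ([:[:v1:]:] * h) + pderiv u * dX W + (dX u)\<^sup>2 = 0"
  proof -
    have "pderiv ([:[:v1:]:] * h) + pderiv u * dX W + (dX u)\<^sup>2 =
        - (dX u * pderiv W - pderiv u * dX W - coeff v 1 * pderiv h)"
      unfolding dY.mult W v1 by (simp add: power2_eq_square)
    also have "\<dots> = 0" using e2[of 0] unfolding W_def by simp
    finally show ?thesis .
  qed
  have "dX u * pderiv ([:[:v1:]:] * h) = pderiv u * dX ([:[:v1:]:] * h)"
    using det unfolding dY.mult dX.mult by (auto simp: v pderiv_pCons)
  with v W k show "\<exists>W v1. v = [:W, [:[:v1:]:]:] \<and> pderiv W = - dX u \<and>
      pderiv ([:[:v1:]:] * h) + pderiv u * dX W + (dX u)\<^sup>2 = 0 \<and>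
      dX u * pderiv ([:[:v1:]:] * h) = pderiv u * dX ([:[:v1:]:] * h)" by blast
qed

section \<open>Translation to three variables and conclusion\<close>

lemma subst3_incl_xy:
  "subst3 g (incl_xy q) = incl_xy (pcompose (map_poly (\<lambda>c. [:c:]) g) q)"
  by (induction g) (simp_all add: subst3_def incl_xy_def const3_def map_poly_pCons pcompose_pCons mult.commute)

lemma subst3_X3: "subst3 b X3 = incl_xy [:b:]"
  by (induction b) (simp_all add: subst3_def incl_xy_def const3_def X3_def map_poly_pCons)

lemma linear_in_Y3: "const3 1 * Y3 + subst3 b X3 = incl_xy [:b, 1:]"
  unfolding subst3_X3 by (simp add: const3_def Y3_def incl_xy_def)

theorem theorem2p2:
  fixes u h :: "'a::{alg_closed_field, field_char_0} poly poly"
    and v :: "'a poly poly poly"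
  assumes "eval3 (incl_xy u) 0 0 0 = 0" and "eval3 v 0 0 0 = 0" and "eval3 (incl_xy h) 0 0 0 = 0"
    and "lin_indep3 (incl_xy u) v (incl_xy h)"
    and "nilpotent_mat (jacobian_mat (incl_xy u) v (incl_xy h))"
    and "gcd (deg_y u) (deg_y h) \<le> 3"
  shows "\<exists>(g::'a poly) (b::'a poly) (v1::'a) (c0::'a) (a::'a) (l1::'a) (l2::'a) (l2'::'a).
           v1 \<noteq> 0 \<and> c0 \<noteq> 0 \<and> a \<noteq> 0 \<and>
           b = [:l2', l1, v1 * c0 * a:] \<and>
           poly g 0 = 0 \<and> degree g \<ge> 1 \<and>
           incl_xy u = subst3 g (const3 a * Y3 + subst3 b X3) \<and>
           v = const3 v1 * Z3
               - const3 (inverse a) * subst3 (pderiv b) X3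
                   * subst3 g (const3 a * Y3 + subst3 b X3)
               - const3 (v1 * l2) * X3 \<and>
           incl_xy h = const3 c0 * (incl_xy u)^2 + const3 l2 * incl_xy u"
proof -
  have u0: "poly (poly u 0) 0 = 0" and h0: "poly (poly h 0) 0 = 0"
    using assms(1,3) by (simp_all add: eval3_def incl_xy_def)
  have indep_uh: "p = 0 \<and> q = 0" if "[:[:p:]:] * u + [:[:q:]:] * h = 0" for p q
  proof -
    have "const3 p * incl_xy u + const3 0 * v + const3 q * incl_xy h = incl_xy ([:[:p:]:] * u + [:[:q:]:] * h)"
      by (simp add: const3_def incl_xy_def)
    then show ?thesis using assms(4) that unfolding lin_indep3_def by (auto simp: incl_xy_def)
  qed
  note J = nilpotent_jacobian[OF assms(5)]
  have u_y: "pderiv u \<noteq> 0"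
    using linear_in_z(1)[OF J indep_uh u0 h0] .
  obtain W v1 where v: "v = [:W, [:[:v1:]:]:]" and W: "pderiv W = - dX u"
    and k: "pderiv ([:[:v1:]:] * h) + pderiv u * dX W + (dX u)\<^sup>2 = 0"
    and uk: "dX u * pderiv ([:[:v1:]:] * h) = pderiv u * dX ([:[:v1:]:] * h)"
    using linear_in_z(2)[OF J indep_uh u0 h0] by blast
  have W0: "poly (poly W 0) 0 = 0" using assms(2) by (simp add: eval3_def v)
  have "poly (poly ([:[:v1:]:] * h) 0) 0 = 0" using h0 by simp
  from planar_solution[OF u_y W k uk u0 W0 this]
  obtain g l c m where u: "u = pcompose (map_poly (\<lambda>c. [:c:]) g) [:[:0, l, c:], 1:]"
    and g0: "poly g 0 = 0"
    and Weq: "W = - ([:pderiv [:0, l, c:]:] * u) + [:[:0, m:]:]"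
    and keq: "[:[:v1:]:] * h = [:[:c:]:] * u\<^sup>2 - [:[:m:]:] * u" by blast
  \<comment> \<open>Otherwise \<open>c * u\<close> would be the constant \<open>m\<close>, so
    \<open>c = m = 0\<close>, and then \<open>v = - l * u\<close> contradicts independence.\<close>
  have v1: "v1 \<noteq> 0"
  proof
    assume "v1 = 0"
    then have "u * ([:[:c:]:] * u - [:[:m:]:]) = 0"
      using keq by (simp add: power2_eq_square algebra_simps)
    moreover have "u \<noteq> 0" using u_y by auto
    ultimately have cu: "[:[:c:]:] * u = [:[:m:]:]" by simp
    then have "pderiv ([:[:c:]:] * u) = 0" by simp
    with u_y have "c = 0" by (simp add: pderiv_smult)
    with cu have "m = 0" by simp
    have "const3 l * incl_xy u + const3 1 * v + const3 0 * incl_xy h = 0"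
      using Weq \<open>c = 0\<close> \<open>m = 0\<close> \<open>v1 = 0\<close>
      by (simp add: v const3_def incl_xy_def pderiv_pCons)
    then show False using assms(4) unfolding lin_indep3_def by (metis zero_neq_one)
  qed
  \<comment> \<open>Without the quadratic term, \<open>h\<close> would be proportional to
    \<open>u\<close>.\<close>
  have c: "c \<noteq> 0"
  proof
    assume "c = 0"
    with keq have "[:[:m:]:] * u + [:[:v1:]:] * h = 0" by simp
    with indep_uh v1 show False by blast
  qed
  have "degree g \<noteq> 0"
  proof
    assume "degree g = 0"
    then obtain r where "g = [:r:]" by (rule degree_eq_zeroE)
    with g0 have "g = 0" by simp
    with u u_y show False by simp
  qed
  have sub: "subst3 g (const3 1 * Y3 + subst3 [:0, l, c:] X3) = incl_xy u"
    unfolding linear_in_Y3 subst3_incl_xy u[symmetric] ..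
  have veq: "v = const3 v1 * Z3 - const3 1 * subst3 (pderiv [:0, l, c:]) X3 * incl_xy u
      - const3 (- m) * X3"
    unfolding v Weq subst3_X3
    by (simp add: const3_def Z3_def X3_def incl_xy_def)
  have neg: "[:[:- r:]:] * u = - ([:[:r:]:] * u)" for r
  proof -
    have "[:[:- r:]:] = - [:[:r:]:]" by simp
    then show ?thesis by (simp only: minus_mult_left)
  qed
  have "h = [:[:inverse v1:]:] * ([:[:v1:]:] * h)" using v1 by (simp flip: one_pCons)
  also have "\<dots> = [:[:c / v1:]:] * u\<^sup>2 + [:[:- (m / v1):]:] * u"
    unfolding keq neg by (simp add: smult_diff_right divide_inverse mult.commute)
  finally have heq: "incl_xy h = const3 (c / v1) * (incl_xy u)\<^sup>2 + const3 (- (m / v1)) * incl_xy u"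
    by (simp add: incl_xy_def const3_def power2_eq_square)
  \<comment> \<open>The normalisation is \<open>a = 1\<close> with zero constant term in
    \<open>b\<close>. Dividing \<open>v1 * h\<close> by \<open>v1\<close> gives
    \<open>c0 = c / v1\<close> and \<open>l2 = - (m / v1)\<close>, so that
    \<open>v1 * c0 * a = c\<close> and \<open>v1 * l2 = - m\<close>.\<close>
  show ?thesis
  proof (rule exI[of _ g], rule exI[of _ "[:0, l, c:]"], rule exI[of _ v1], rule exI[of _ "c / v1"],
      rule exI[of _ 1], rule exI[of _ l], rule exI[of _ "- (m / v1)"], rule exI[of _ 0], intro conjI)
    have "v1 * - (m / v1) = - m" using v1 by simp
    then show "v = const3 v1 * Z3 - const3 (inverse 1) * subst3 (pderiv [:0, l, c:]) X3
        * subst3 g (const3 1 * Y3 + subst3 [:0, l, c:] X3) - const3 (v1 * - (m / v1)) * X3"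
      using veq by (simp only: sub inverse_1)
    show "degree g \<ge> 1" using \<open>degree g \<noteq> 0\<close> by simp
  qed (use v1 c g0 sub heq in simp_all)
qed

end
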